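(* Given a tuple of $m$ symmetric positive semidefinite matrices $A_1,\dots,A_m\in\mathbb{R}^{d\times d}$ with $d\le m$ and $k\in\{1,\dots,d\}$, there exists a tuple of $m+d-k$ symmetric positive semidefinite matrices $B_1,\dots,B_{m+d-k}\in\mathbb{R}^{(m+d-k)\times(m+d-k)}$ such that the coefficient of $x^{d-k}$ in the mixed characteristic polynomial $\mu[A_1,\dots,A_m](x)$, up to the sign $(-1)^k$, satisfies $$\sum_{S\subseteq[m],\ |S|=k}D\big((A_i)_{i\in S}\big)=\frac{1}{(m-k)!\,(d-k)!}\,D(B_1,\dots,B_{m+d-k});$$ that is, the coefficient of $x^{d-k}$ in $\mu[A_1,\dots,A_m](x)$ equals $(-1)^k$ times the left-hand sum, and the displayed equality holds.
   Context: $[m]=\{1,\dots,m\}$. For symmetric $M_1,\dots,M_N\in\mathbb{R}^{N\times N}$ the mixed discriminant is $D(M_1,\dots,M_N)=\frac{\partial^N}{\partial z_1\cdots\partial z_N}\det(z_1M_1+\dots+z_NM_N)$. For $k\le d$ symmetric $d\times d$ matrices $A_1,\dots,A_k$, set $D(A_1,\dots,A_k)=\frac{1}{(d-k)!}D(A_1,\dots,A_k,I,\dots,I)$ with the $d\times d$ identity matrix $I$ repeated $d-k$ times. The mixed characteristic polynomial of symmetric $A_1,\dots,A_m\in\mathbb{R}^{d\times d}$ is $\mu[A_1,\dots,A_m](x)=\prod_{i=1}^m(1-\frac{\partial}{\partial z_i})\det(xI+\sum_{i=1}^mz_iA_i)\big|_{z_1=\dots=z_m=0}$. *)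

theory Defs
  imports "HOL-Analysis.Derivative" "Jordan_Normal_Form.Determinant"
begin

no_notation inner (infix "\<bullet>" 70)

definition psd_mat :: "nat \<Rightarrow> real mat \<Rightarrow> bool" where
  "psd_mat n M \<longleftrightarrow> M \<in> carrier_mat n n \<and> transpose_mat M = M \<and>
    (\<forall>v \<in> carrier_vec n. 0 \<le> v \<bullet> (M *\<^sub>v v))"

definition partial :: "nat \<Rightarrow> ((nat \<Rightarrow> real) \<Rightarrow> real) \<Rightarrow> (nat \<Rightarrow> real) \<Rightarrow> real" where
  "partial i F z = deriv (\<lambda>t. F (z(i := t))) (z i)"

definition one_minus_partial :: "nat \<Rightarrow> ((nat \<Rightarrow> real) \<Rightarrow> real) \<Rightarrow> (nat \<Rightarrow> real) \<Rightarrow> real" where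
  "one_minus_partial i F z = F z - partial i F z"

definition lincomb_mat :: "nat \<Rightarrow> real mat list \<Rightarrow> (nat \<Rightarrow> real) \<Rightarrow> real mat" where
  "lincomb_mat n Ms z = mat n n (\<lambda>(r, c). \<Sum>i<length Ms. z i * Ms ! i $$ (r, c))"

text \<open>Meaningful for N matrices of size N by N. The determinant is then a homogeneous polynomial
  of degree N in the N variables, so its mixed partial derivative is a constant, and evaluating
  it at the origin is only a way of naming that constant.\<close>

definition mixed_disc :: "real mat list \<Rightarrow> real" where
  "mixed_disc Ms =
    foldr partial [0..<length Ms] (\<lambda>z. det (lincomb_mat (length Ms) Ms z)) (\<lambda>_. 0)"

text \<open>The mixed discriminant of k matrices of size d by d, k at most d; for k = d it agrees
  with the unpadded one.\<close>

definition mixed_disc_pad :: "nat \<Rightarrow> real mat list \<Rightarrow> real" where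
  "mixed_disc_pad d Ms =
    1 / fact (d - length Ms) * mixed_disc (Ms @ replicate (d - length Ms) (1\<^sub>m d))"

definition mixed_char :: "nat \<Rightarrow> real mat list \<Rightarrow> real \<Rightarrow> real" where
  "mixed_char d As x =
    foldr one_minus_partial [0..<length As]
      (\<lambda>z. det (x \<cdot>\<^sub>m 1\<^sub>m d + lincomb_mat d As z)) (\<lambda>_. 0)"

end

theory Submission
  imports Defs
begin

text \<open>
  The polynomial \<open>P(z, x) = det (x I + \<Sum> z_i A_i)\<close> is homogeneous of degree \<open>d\<close>. Let \<open>C\<close> be the sum of
  its coefficients at the monomials \<open>x^(d - k) z^S\<close> with \<open>|S| = k\<close> and \<open>z^S = \<Prod>i\<in>S. z_i\<close>. At \<open>z = 0\<close> the
  operator \<open>\<Prod> (1 - \<partial>_i)\<close> kills every monomial that is not multiaffine in \<open>z\<close> and sends \<open>x^(d - k) z^S\<close>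
  to \<open>(- 1)^k x^(d - k)\<close>, so the coefficient of the mixed characteristic polynomial is \<open>(- 1)^k C\<close>.
  Substituting \<open>w_1 + \<dots> + w_(d - k)\<close> for \<open>x\<close> shows that \<open>D(A_S)\<close> is the coefficient at
  \<open>x^(d - k) z^S\<close>, hence the sum of these padded mixed discriminants is \<open>C\<close>. Finally take
  \<open>B_i = A_i \<oplus> I\<close> with an identity block of size \<open>m - k\<close> for \<open>i \<le> m\<close>, and \<open>d - k\<close> copies of \<open>I \<oplus> 0\<close>. Then
  \<open>det (\<Sum> z_i B_i + \<Sum> w_l B_(m + l)) = P(z, \<Sum> w_l) (\<Sum> z_i)^(m - k)\<close>. In the multiaffine part,
  the \<open>m - k\<close> variables \<open>z_i\<close> missing from \<open>z^S\<close> come from the last factor, in \<open>(m - k)!\<close> ways.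
\<close>

section \<open>Operators s + e d/dz_i on sums of monomials\<close>

text \<open>The pair (s, e) = (0, 1) gives \<open>partial\<close> and (1, -1) gives
  \<open>one_minus_partial\<close>, so one calculation serves both the mixed discriminant and the
  mixed characteristic polynomial.\<close>

definition affine_partial ::
    "real \<Rightarrow> real \<Rightarrow> nat \<Rightarrow> ((nat \<Rightarrow> real) \<Rightarrow> real) \<Rightarrow> (nat \<Rightarrow> real) \<Rightarrow> real" where
  "affine_partial s e i F z = s * F z + e * partial i F z"

lemma partial_eq_affine_partial: "partial = affine_partial 0 1"
  by (intro ext) (simp add: affine_partial_def)

lemma one_minus_partial_eq_affine_partial: "one_minus_partial = affine_partial 1 (- 1)"
  by (intro ext) (simp add: affine_partial_def one_minus_partial_def)

text \<open>In a product of one-variable functions the operator changes only the factor of variable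
  i. The result has the same shape, so operators in further variables can follow; the factors are
  arbitrary because earlier operators turn powers into other functions.\<close>

lemma affine_partial_sum_prod:
  fixes c :: "'j \<Rightarrow> real"
  assumes "finite A" "i \<in> A"
    and der: "\<And>j t. (\<phi> j i has_field_derivative \<phi>' j t) (at t)"
  shows "affine_partial s e i (\<lambda>z. \<Sum>j\<in>J. c j * (\<Prod>l\<in>A. \<phi> j l (z l))) =
    (\<lambda>z. \<Sum>j\<in>J. c j * (\<Prod>l\<in>A. if l = i then s * \<phi> j i (z i) + e * \<phi>' j (z i) else \<phi> j l (z l)))"
proof
  fix z :: "nat \<Rightarrow> real"
  define R where "R j = (\<Prod>l\<in>A - {i}. \<phi> j l (z l))" for j
  have split: "(\<Prod>l\<in>A. \<phi> j l ((z(i := t)) l)) = \<phi> j i t * R j" for j t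
    unfolding prod.remove[OF assms(1,2)] R_def by simp
  have "((\<lambda>t. \<Sum>j\<in>J. c j * (\<phi> j i t * R j)) has_field_derivative
      (\<Sum>j\<in>J. c j * (\<phi>' j (z i) * R j))) (at (z i))"
    by (intro DERIV_sum DERIV_cmult DERIV_cmult_right der)
  then have "partial i (\<lambda>z. \<Sum>j\<in>J. c j * (\<Prod>l\<in>A. \<phi> j l (z l))) z =
      (\<Sum>j\<in>J. c j * (\<phi>' j (z i) * R j))"
    unfolding partial_def split by (rule DERIV_imp_deriv)
  moreover have "(\<Prod>l\<in>A. \<phi> j l (z l)) = \<phi> j i (z i) * R j" for j
    using split[of j "z i"] by simp
  moreover have "(\<Prod>l\<in>A. if l = i then s * \<phi> j i (z i) + e * \<phi>' j (z i) else \<phi> j l (z l)) =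
      (s * \<phi> j i (z i) + e * \<phi>' j (z i)) * R j" for j
    unfolding prod.remove[OF assms(1,2)] R_def by simp
  ultimately show "affine_partial s e i (\<lambda>z. \<Sum>j\<in>J. c j * (\<Prod>l\<in>A. \<phi> j l (z l))) z =
    (\<Sum>j\<in>J. c j * (\<Prod>l\<in>A. if l = i then s * \<phi> j i (z i) + e * \<phi>' j (z i) else \<phi> j l (z l)))"
    by (simp add: affine_partial_def sum_distrib_left sum.distrib algebra_simps)
qed

lemma foldr_affine_partial_monomials:
  fixes c :: "'j \<Rightarrow> real"
  assumes "finite A" "distinct xs" "set xs \<subseteq> A"
  shows "foldr (affine_partial s e) xs (\<lambda>z. \<Sum>j\<in>J. c j * (\<Prod>l\<in>A. z l ^ a j l)) =
    (\<lambda>z. \<Sum>j\<in>J. c j * (\<Prod>l\<in>A. if l \<in> set xs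
       then s * z l ^ a j l + e * (real (a j l) * z l ^ (a j l - 1)) else z l ^ a j l))"
  using assms(2,3)
proof (induction xs)
  case (Cons x xs)
  \<comment> \<open>The factor of variable l once the operators of \<open>xs\<close> have
    acted.\<close>
  define \<phi> where "\<phi> j l t = (if l \<in> set xs
       then s * t ^ a j l + e * (real (a j l) * t ^ (a j l - 1)) else t ^ a j l)" for j l and t :: real
  have x: "x \<notin> set xs" "x \<in> A" using Cons.prems by auto
  \<comment> \<open>Since \<open>x\<close> is not in \<open>xs\<close>, its factor is still a pure
    power. At exponent 0 the truncated \<open>a j x - 1\<close> is harmless, as the coefficient in
    front is 0.\<close>
  have der: "(\<phi> j x has_field_derivative real (a j x) * t ^ (a j x - 1)) (at t)" for j t
    using x DERIV_pow[of "a j x" t UNIV] by (simp add: \<phi>_def[abs_def])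
  have "affine_partial s e x (\<lambda>z. \<Sum>j\<in>J. c j * (\<Prod>l\<in>A. \<phi> j l (z l))) =
    (\<lambda>z. \<Sum>j\<in>J. c j * (\<Prod>l\<in>A. if l = x then s * \<phi> j x (z x) +
        e * (real (a j x) * z x ^ (a j x - 1)) else \<phi> j l (z l)))"
    by (rule affine_partial_sum_prod[where \<phi> = \<phi> and \<phi>' = "\<lambda>j t. real (a j x) * t ^ (a j x - 1)",
          OF assms(1) x(2) der])
  moreover have "foldr (affine_partial s e) xs (\<lambda>z. \<Sum>j\<in>J. c j * (\<Prod>l\<in>A. z l ^ a j l)) =
      (\<lambda>z. \<Sum>j\<in>J. c j * (\<Prod>l\<in>A. \<phi> j l (z l)))"
    using Cons unfolding \<phi>_def by auto
  ultimately have "foldr (affine_partial s e) (x # xs) (\<lambda>z. \<Sum>j\<in>J. c j * (\<Prod>l\<in>A. z l ^ a j l)) =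
    (\<lambda>z. \<Sum>j\<in>J. c j * (\<Prod>l\<in>A. if l = x then s * \<phi> j x (z x) +
        e * (real (a j x) * z x ^ (a j x - 1)) else \<phi> j l (z l)))"
    by simp
  then show ?case
    using x by (auto simp: \<phi>_def intro!: ext sum.cong prod.cong arg_cong2[of _ _ _ _ times])
qed simp

text \<open>At the origin \<open>s * t ^ a + e * (a * t ^ (a - 1))\<close> is s for a = 0, e for a =
  1 and 0 for larger a, because \<open>0 ^ 0 = 1\<close>.\<close>

lemma foldr_affine_partial_monomials_0:
  fixes c :: "'j \<Rightarrow> real"
  shows "foldr (affine_partial s e) [0..<n] (\<lambda>z. \<Sum>j\<in>J. c j * (\<Prod>l<n. z l ^ a j l)) (\<lambda>_. 0) =
    (\<Sum>j\<in>J. c j * (\<Prod>l<n. if a j l = 0 then s else if a j l = 1 then e else 0))"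
  by (subst foldr_affine_partial_monomials)
    (auto simp: power_0_left intro!: sum.cong prod.cong arg_cong2[of _ _ _ _ times])

lemma prod_if_1_0: "finite A \<Longrightarrow> (\<Prod>l\<in>A. if P l then 1 else 0) = (if \<forall>l\<in>A. P l then 1 else (0::real))"
  by (induction A rule: finite_induct) auto

lemma foldr_partial_monomials_0:
  fixes c :: "'j \<Rightarrow> real"
  shows "foldr partial [0..<n] (\<lambda>z. \<Sum>j\<in>J. c j * (\<Prod>l<n. z l ^ a j l)) (\<lambda>_. 0) =
    (\<Sum>j\<in>J. if \<forall>l<n. a j l = 1 then c j else 0)"
proof -
  have "(\<Prod>l<n. if a j l = 0 then 0 else if a j l = 1 then 1 else (0::real)) =
      (\<Prod>l<n. if a j l = 1 then 1 else 0)" for j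
    by (intro prod.cong) auto
  then show ?thesis
    unfolding partial_eq_affine_partial foldr_affine_partial_monomials_0
    by (auto simp: prod_if_1_0 intro!: sum.cong)
qed

section \<open>Choice functions, their fibres and exponent vectors\<close>

lemma prod_fibres:
  fixes z :: "'i \<Rightarrow> 'a :: comm_monoid_mult"
  assumes "finite R" "finite I" "g \<in> R \<rightarrow> I"
  shows "(\<Prod>r\<in>R. z (g r)) = (\<Prod>i\<in>I. z i ^ card {r \<in> R. g r = i})"
proof -
  have "(\<Prod>r\<in>R. z (g r)) = (\<Prod>i\<in>I. \<Prod>r\<in>{r \<in> R. g r = i}. z (g r))"
    using assms by (intro prod.group[symmetric]) auto
  also have "\<dots> = (\<Prod>i\<in>I. \<Prod>r\<in>{r \<in> R. g r = i}. z i)"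
    by (intro prod.cong) auto
  finally show ?thesis by simp
qed

lemma sum_card_fibres:
  assumes "finite R" "finite I" "g \<in> R \<rightarrow> I"
  shows "(\<Sum>i\<in>I. card {r \<in> R. g r = i}) = card R"
  using sum.group[of R I g "\<lambda>_. 1::nat"] assms by (auto simp: Pi_def)

text \<open>Here \<open>a\<close> holds the exponents already present and \<open>h\<close> assigns
  \<open>card R\<close> further factors to variables. Exponent 1 everywhere forces \<open>h\<close>
  to be a bijection from \<open>R\<close> onto the zero set of \<open>a\<close>, which has the right
  size by the degree condition. All factorials of the theorem arise from this count.\<close>

lemma card_PiE_fibres:
  fixes a :: "'i \<Rightarrow> nat"
  assumes "finite R" "finite I" "(\<Sum>i\<in>I. a i) + card R = card I"
  shows "card {h \<in> R \<rightarrow>\<^sub>E I. \<forall>i\<in>I. a i + card {r \<in> R. h r = i} = 1} =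
    (if \<forall>i\<in>I. a i \<le> 1 then fact (card R) else 0)"
proof (cases "\<forall>i\<in>I. a i \<le> 1")
  case False
  then obtain i where "i \<in> I" "a i > 1" by (auto simp: not_le)
  then have "{h \<in> R \<rightarrow>\<^sub>E I. \<forall>i\<in>I. a i + card {r \<in> R. h r = i} = 1} = {}"
    by force
  then show ?thesis using False by (metis card.empty)
next
  case True
  define Z where "Z = {i \<in> I. a i = 0}"
  have Z: "Z \<subseteq> I" "finite Z" using assms by (auto simp: Z_def)
  have "(\<Sum>i\<in>I. a i) = (\<Sum>i\<in>I - Z. 1)"
    using True Z by (intro sum.mono_neutral_cong_right)
      (auto simp: Z_def assms le_Suc_eq)
  then have cZ: "card Z = card R"
    using assms Z by (simp add: card_Diff_subset) (metis Z(1) assms(2) card_mono add_diff_cancel_left' le_add_diff_inverse2)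
  \<comment> \<open>A nonempty fibre leaves room only for exponent 0 in \<open>a\<close> and for a
    single element. Conversely an injection into \<open>Z\<close> is onto, the sizes being
    equal.\<close>
  have "{h \<in> R \<rightarrow>\<^sub>E I. \<forall>i\<in>I. a i + card {r \<in> R. h r = i} = 1} = {h \<in> R \<rightarrow>\<^sub>E Z. inj_on h R}"
    (is "?L = ?M")
  proof (intro equalityI subsetI)
    fix h assume h: "h \<in> ?L"
    have *: "h r \<in> Z" if "r \<in> R" for r
    proof -
      have "card {r' \<in> R. h r' = h r} > 0" using that assms by (auto simp: card_gt_0_iff)
      then show ?thesis using h that by (auto simp: Z_def PiE_iff) (metis add_is_1 gr0_implies_Suc nat.simps(3))
    qed
    have "r = r'" if "r \<in> R" "r' \<in> R" "h r = h r'" for r r'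
    proof -
      have "card {x \<in> R. h x = h r} = 1"
        using h *[OF that(1)] that by (auto simp: Z_def)
      then obtain x where "{x \<in> R. h x = h r} = {x}" by (rule card_1_singletonE)
      then have "r \<in> {x}" "r' \<in> {x}" using that by auto
      then show ?thesis by simp
    qed
    then show "h \<in> ?M" using * h by (auto simp: inj_on_def PiE_iff)
  next
    fix h assume h: "h \<in> ?M"
    then have "h ` R = Z"
      using cZ Z by (intro card_subset_eq) (auto simp: card_image)
    moreover have "card {r \<in> R. h r = i} = (if i \<in> h ` R then 1 else 0)" for i
    proof (cases "i \<in> h ` R")
      case True
      then obtain r where "r \<in> R" "i = h r" by auto
      then have "{r \<in> R. h r = i} = {r}" using h by (auto simp: inj_on_def)
      then show ?thesis using True by simp
    next
      case False
      then have "{r \<in> R. h r = i} = {}" by auto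
      then show ?thesis using False by (simp only: card.empty if_False)
    qed
    ultimately show "h \<in> ?L"
      using h True Z by (auto simp: Z_def PiE_iff le_Suc_eq)
  qed
  \<comment> \<open>Injections are counted by a falling factorial, which is a full factorial when
    both sets have equal size.\<close>
  moreover have "prod ((-) (card Z)) {0..<card R} = fact (card R)"
    unfolding cZ by (simp add: fact_prod_rev)
  ultimately show ?thesis
    using True card_inj_on_subset_funcset[of R Z R] assms Z by simp
qed

text \<open>The multinomial expansion indexed by choice functions rather than exponent vectors: no
  multinomial coefficients appear, and multiplicities become cardinalities of sets of
  functions.\<close>

lemma sum_power_fibres:
  fixes z :: "'i \<Rightarrow> real"
  assumes "finite I"
  shows "(\<Sum>i\<in>I. z i) ^ q =
    (\<Sum>h\<in>{..<q} \<rightarrow>\<^sub>E I. \<Prod>i\<in>I. z i ^ card {r \<in> {..<q}. h r = i})"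
proof -
  have "(\<Sum>i\<in>I. z i) ^ q = (\<Prod>r<q. \<Sum>i\<in>I. z i)" by simp
  also have "\<dots> = (\<Sum>h\<in>{..<q} \<rightarrow>\<^sub>E I. \<Prod>r<q. z (h r))"
    using assms by (intro prod_sum_PiE) auto
  also have "\<dots> = (\<Sum>h\<in>{..<q} \<rightarrow>\<^sub>E I. \<Prod>i\<in>I. z i ^ card {r \<in> {..<q}. h r = i})"
    using assms by (intro sum.cong prod_fibres) (auto simp: PiE_def)
  finally show ?thesis .
qed


section \<open>The full mixed partial of monomials times powers of linear forms\<close>

lemma prod_lessThan_add:
  fixes f :: "nat \<Rightarrow> 'a :: comm_monoid_mult"
  shows "(\<Prod>l<n + p. f l) = (\<Prod>l<n. f l) * (\<Prod>l<p. f (n + l))"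
  by (induction p) (simp_all add: mult.assoc)

lemma sum_lessThan_add:
  fixes f :: "nat \<Rightarrow> 'a :: comm_monoid_add"
  shows "(\<Sum>l<n + p. f l) = (\<Sum>l<n. f l) + (\<Sum>l<p. f (n + l))"
  by (induction p) (simp_all add: add.assoc)

lemma sum_Times_if:
  fixes c :: real
  assumes "finite H" "finite H'"
  shows "(\<Sum>(h, h')\<in>H \<times> H'. if P h \<and> Q h' then c else 0) =
    c * real (card {h \<in> H. P h}) * real (card {h' \<in> H'. Q h'})"
proof -
  have "(\<Sum>(h, h')\<in>H \<times> H'. if P h \<and> Q h' then c else 0) =
      (\<Sum>x\<in>{h \<in> H. P h} \<times> {h' \<in> H'. Q h'}. c)"
    using assms by (intro sum.mono_neutral_cong_right) (auto split: if_splits)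
  then show ?thesis by (simp add: card_cartesian_product)
qed

text \<open>Both powers are expanded over choice functions. Surviving terms have exponent 1 in every
  variable: the first power completes \<open>a j\<close> in \<open>fact q\<close> ways, the second
  uses each of the last p variables once, in \<open>fact p\<close> ways. Padded discriminants are
  the case q = 0; the block matrices have q = m - k.\<close>

lemma foldr_partial_monomials_powers_0:
  fixes c :: "'j \<Rightarrow> real"
  assumes "finite J"
    and hom: "\<And>j. j \<in> J \<Longrightarrow> b j = p \<Longrightarrow> (\<Sum>i<n. a j i) + q = n"
  shows "foldr partial [0..<n + p] (\<lambda>z. \<Sum>j\<in>J. c j * (\<Prod>i<n. z i ^ a j i) *
      (\<Sum>i<n. z i) ^ q * (\<Sum>l<p. z (n + l)) ^ b j) (\<lambda>_. 0) =
    (\<Sum>j\<in>J. if b j = p \<and> (\<forall>i<n. a j i \<le> 1) then c j * fact q * fact p else 0)"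
proof -
  define H where "H = ({..<q} \<rightarrow>\<^sub>E {..<n})"
  define H' where "H' j = ({..<b j} \<rightarrow>\<^sub>E {..<p})" for j
  have fin: "finite H" "finite (H' j)" for j
    by (auto simp: H_def H'_def intro!: finite_PiE)
  \<comment> \<open>The exponent of variable l in the term chosen by
    \<open>(j, h, h')\<close>.\<close>
  define \<alpha> where "\<alpha> = (\<lambda>(j, h, h') l. if l < n then a j l + card {r \<in> {..<q}. h r = l}
      else card {r \<in> {..<b j}. h' r = l - n})"
  have "(\<Sum>j\<in>J. c j * (\<Prod>i<n. z i ^ a j i) * (\<Sum>i<n. z i) ^ q * (\<Sum>l<p. z (n + l)) ^ b j) =
      (\<Sum>x\<in>(SIGMA j:J. H \<times> H' j). c (fst x) * (\<Prod>l<n + p. z l ^ \<alpha> x l))" for z :: "nat \<Rightarrow> real"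
  proof -
    have "c j * (\<Prod>i<n. z i ^ a j i) * (\<Sum>i<n. z i) ^ q * (\<Sum>l<p. z (n + l)) ^ b j =
        (\<Sum>y\<in>H \<times> H' j. c j * (\<Prod>l<n + p. z l ^ \<alpha> (j, y) l))" for j
    proof -
      have "(\<Prod>l<n + p. z l ^ \<alpha> (j, h, h') l) = (\<Prod>i<n. z i ^ a j i) *
          ((\<Prod>i<n. z i ^ card {r \<in> {..<q}. h r = i}) *
           (\<Prod>l<p. z (n + l) ^ card {r \<in> {..<b j}. h' r = l}))" for h h'
        by (simp add: prod_lessThan_add \<alpha>_def power_add prod.distrib mult.assoc)
      then show ?thesis
        unfolding sum_power_fibres[OF finite_lessThan]
        by (simp add: H_def H'_def sum.cartesian_product' sum_distrib_left[symmetric] sum_product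
              mult.assoc)
    qed
    then show ?thesis using assms(1) fin by (simp add: sum.Sigma split_def)
  qed
  then have "foldr partial [0..<n + p] (\<lambda>z. \<Sum>j\<in>J. c j * (\<Prod>i<n. z i ^ a j i) *
      (\<Sum>i<n. z i) ^ q * (\<Sum>l<p. z (n + l)) ^ b j) (\<lambda>_. 0) =
      (\<Sum>x\<in>(SIGMA j:J. H \<times> H' j). if \<forall>l<n + p. \<alpha> x l = 1 then c (fst x) else 0)"
    by (simp add: foldr_partial_monomials_0)
  also have "\<dots> = (\<Sum>j\<in>J. \<Sum>y\<in>H \<times> H' j. if \<forall>l<n + p. \<alpha> (j, y) l = 1 then c j else 0)"
    using assms(1) fin by (simp add: sum.Sigma split_def)
  also have "\<dots> = (\<Sum>j\<in>J. if b j = p \<and> (\<forall>i<n. a j i \<le> 1) then c j * fact q * fact p else 0)"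
  proof (intro sum.cong refl)
    fix j assume j: "j \<in> J"
    define P where "P h \<longleftrightarrow> (\<forall>i\<in>{..<n}. a j i + card {r \<in> {..<q}. h r = i} = 1)" for h :: "nat \<Rightarrow> nat"
    \<comment> \<open>The summand 0 is the zero exponent vector, giving the shape that
      \<open>card_PiE_fibres\<close> counts.\<close>
    define Q where "Q h' \<longleftrightarrow> (\<forall>i\<in>{..<p}. 0 + card {r \<in> {..<b j}. h' r = i} = 1)" for h' :: "nat \<Rightarrow> nat"
    have "(\<forall>l<n + p. \<alpha> (j, h, h') l = 1) \<longleftrightarrow> P h \<and> Q h'" (is "?l \<longleftrightarrow> ?r") for h h'
    proof
      assume l: ?l
      have "\<alpha> (j, h, h') i = 1" if "i < n" for i using l that by auto
      moreover have "\<alpha> (j, h, h') (n + i) = 1" if "i < p" for i using l that by auto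
      ultimately show ?r by (auto simp: \<alpha>_def P_def Q_def)
    next
      assume r: ?r
      show ?l
      proof (intro allI impI)
        fix l assume "l < n + p"
        then show "\<alpha> (j, h, h') l = 1"
          using r by (cases "l < n") (auto simp: \<alpha>_def P_def Q_def)
      qed
    qed
    note eq = this
    have "(\<Sum>y\<in>H \<times> H' j. if \<forall>l<n + p. \<alpha> (j, y) l = 1 then c j else 0) =
        (\<Sum>(h, h')\<in>H \<times> H' j. if P h \<and> Q h' then c j else 0)"
      by (intro sum.cong refl, clarify) (simp only: eq split_conv)
    also have "\<dots> = c j * real (card {h \<in> H. P h}) * real (card {h' \<in> H' j. Q h'})"
      by (rule sum_Times_if[OF fin])
    also have "\<dots> = (if b j = p \<and> (\<forall>i<n. a j i \<le> 1) then c j * fact q * fact p else 0)"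
    proof (cases "b j = p")
      case True
      have "card {h \<in> H. P h} = (if \<forall>i\<in>{..<n}. a j i \<le> 1 then fact (card {..<q}) else 0)"
        unfolding H_def P_def using hom[OF j True] by (intro card_PiE_fibres) auto
      moreover have "card {h' \<in> H' j. Q h'} =
          (if \<forall>i\<in>{..<p}. 0 \<le> (1 :: nat) then fact (card {..<b j}) else 0)"
        unfolding H'_def Q_def using True by (intro card_PiE_fibres) auto
      ultimately show ?thesis using True by auto
    next
      case False
      \<comment> \<open>The p fibres of \<open>h'\<close> partition a set of size
        \<open>b j\<close>, so they cannot all be singletons.\<close>
      have "\<not> Q h'" if "h' \<in> H' j" for h'
      proof
        assume "Q h'"
        then have "card {..<p} = (\<Sum>i<p. card {r \<in> {..<b j}. h' r = i})"
          by (simp add: Q_def)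
        also have "\<dots> = card {..<b j}"
          using that by (intro sum_card_fibres) (auto simp: H'_def PiE_def)
        finally show False using False by simp
      qed
      then have "{h' \<in> H' j. Q h'} = {}" by auto
      then have "card {h' \<in> H' j. Q h'} = 0" by (simp only: card.empty)
      then show ?thesis using False by simp
    qed
    finally show "(\<Sum>y\<in>H \<times> H' j. if \<forall>l<n + p. \<alpha> (j, y) l = 1 then c j else 0) =
        (if b j = p \<and> (\<forall>i<n. a j i \<le> 1) then c j * fact q * fact p else 0)" .
  qed
  finally show ?thesis .
qed

section \<open>Leibniz expansion of the determinant of a linear combination\<close>

text \<open>A term is a permutation together with a choice, for each row, of the matrix supplying
  the entry. The exponent of \<open>z i\<close> is the number of rows choosing matrix i, whence
  total degree d. Equal monomials are not collected.\<close>

lemma det_lincomb_mat_expansion: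
  fixes Ms :: "real mat list"
  assumes "length Ms = n"
  obtains J :: "((nat \<Rightarrow> nat) \<times> (nat \<Rightarrow> nat)) set" and c a
  where "finite J" "\<And>j. j \<in> J \<Longrightarrow> (\<Sum>i<n. a j i) = d"
    "\<And>z. det (lincomb_mat d Ms z) = (\<Sum>j\<in>J. c j * (\<Prod>i<n. z i ^ a j i))"
proof
  define J where "J = {\<pi>. \<pi> permutes {0..<d}} \<times> ({0..<d} \<rightarrow>\<^sub>E {..<n})"
  define c where "c = (\<lambda>(\<pi>, g). signof \<pi> * (\<Prod>r = 0..<d. Ms ! g r $$ (r, \<pi> r)))"
  define a where "a = (\<lambda>(\<pi> :: nat \<Rightarrow> nat, g) i. card {r \<in> {0..<d}. g r = (i :: nat)})"
  show "finite J" unfolding J_def by (auto intro!: finite_PiE finite_permutations)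
  show "(\<Sum>i<n. a j i) = d" if "j \<in> J" for j
    using that sum_card_fibres[of "{0..<d}" "{..<n}" "snd j"]
    by (auto simp: J_def a_def split_def PiE_def)
  show "det (lincomb_mat d Ms z) = (\<Sum>j\<in>J. c j * (\<Prod>i<n. z i ^ a j i))" for z
  proof -
    have "det (lincomb_mat d Ms z) = (\<Sum>\<pi>\<in>{\<pi>. \<pi> permutes {0..<d}}. signof \<pi> *
        (\<Prod>r = 0..<d. lincomb_mat d Ms z $$ (r, \<pi> r)))"
      by (intro det_def') (simp add: lincomb_mat_def)
    also have "\<dots> = (\<Sum>\<pi>\<in>{\<pi>. \<pi> permutes {0..<d}}. \<Sum>g\<in>{0..<d} \<rightarrow>\<^sub>E {..<n}.
        c (\<pi>, g) * (\<Prod>i<n. z i ^ a (\<pi>, g) i))"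
    proof (intro sum.cong refl)
      fix \<pi> assume "\<pi> \<in> {\<pi>. \<pi> permutes {0..<d}}"
      then have "\<pi> r < d" if "r < d" for r
        using that permutes_in_image[of \<pi> "{0..<d}" r] by auto
      then have "(\<Prod>r = 0..<d. lincomb_mat d Ms z $$ (r, \<pi> r)) =
          (\<Prod>r = 0..<d. \<Sum>i<n. z i * Ms ! i $$ (r, \<pi> r))"
        using assms by (intro prod.cong) (auto simp: lincomb_mat_def)
      also have "\<dots> = (\<Sum>g\<in>{0..<d} \<rightarrow>\<^sub>E {..<n}. \<Prod>r = 0..<d. z (g r) * Ms ! g r $$ (r, \<pi> r))"
        by (intro prod_sum_PiE) auto
      also have "\<dots> = (\<Sum>g\<in>{0..<d} \<rightarrow>\<^sub>E {..<n}. (\<Prod>r = 0..<d. Ms ! g r $$ (r, \<pi> r)) *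
          (\<Prod>i<n. z i ^ a (\<pi>, g) i))"
      proof (intro sum.cong refl)
        fix g assume "g \<in> {0..<d} \<rightarrow>\<^sub>E {..<n}"
        then have "(\<Prod>r = 0..<d. z (g r)) = (\<Prod>i<n. z i ^ a (\<pi>, g) i)"
          unfolding a_def split_conv by (intro prod_fibres) (auto simp: PiE_def)
        then show "(\<Prod>r = 0..<d. z (g r) * Ms ! g r $$ (r, \<pi> r)) =
            (\<Prod>r = 0..<d. Ms ! g r $$ (r, \<pi> r)) * (\<Prod>i<n. z i ^ a (\<pi>, g) i)"
          by (simp add: prod.distrib)
      qed
      finally show "signof \<pi> * (\<Prod>r = 0..<d. lincomb_mat d Ms z $$ (r, \<pi> r)) =
          (\<Sum>g\<in>{0..<d} \<rightarrow>\<^sub>E {..<n}. c (\<pi>, g) * (\<Prod>i<n. z i ^ a (\<pi>, g) i))"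
        by (simp add: c_def sum_distrib_left mult.assoc)
    qed
    finally show ?thesis
      by (simp add: J_def sum.cartesian_product split_def)
  qed
qed

section \<open>Selected sublists and positive semidefinite blocks\<close>

text \<open>Applying \<open>nths\<close> to the list of positions lists S itself; \<open>e\<close>
  is indexing into that list.\<close>

lemma nths_enumeration:
  assumes "S \<subseteq> {..<length xs}"
  obtains e where "bij_betw e {..<card S} S" "length (nths xs S) = card S"
    "\<And>i. i < card S \<Longrightarrow> nths xs S ! i = xs ! e i"
proof
  define ns where "ns = nths [0..<length xs] S"
  have "nths xs S = map ((!) xs) ns"
    unfolding ns_def nths_map[symmetric] map_nth by simp
  moreover have set: "set ns = S"
  proof -
    have "x \<in> set ns \<longleftrightarrow> x \<in> S" for x
      using assms by (auto simp: ns_def set_nths intro!: exI[of _ x])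
    then show ?thesis by blast
  qed
  moreover have dist: "distinct ns" by (simp add: ns_def)
  moreover have len: "length ns = card S" using distinct_card[OF dist] set by simp
  ultimately show "bij_betw ((!) ns) {..<card S} S" "length (nths xs S) = card S"
    "\<And>i. i < card S \<Longrightarrow> nths xs S ! i = xs ! (ns ! i)"
    by (auto intro!: bij_betw_nth)
qed

lemma psd_one_mat: "psd_mat n (1\<^sub>m n)"
  by (auto simp: psd_mat_def scalar_prod_def intro!: sum_nonneg)

lemma psd_zero_mat: "psd_mat n (0\<^sub>m n n)"
  by (auto simp: psd_mat_def scalar_prod_def)

text \<open>Cutting v along the blocks splits the quadratic form into the sum of those of A and
  B.\<close>

lemma psd_four_block_mat:
  assumes "psd_mat n A" "psd_mat q B"
  shows "psd_mat (n + q) (four_block_mat A (0\<^sub>m n q) (0\<^sub>m q n) B)"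
proof -
  have A: "A \<in> carrier_mat n n" "A\<^sup>T = A" and B: "B \<in> carrier_mat q q" "B\<^sup>T = B"
    using assms by (auto simp: psd_mat_def)
  have "0 \<le> v \<bullet> (four_block_mat A (0\<^sub>m n q) (0\<^sub>m q n) B *\<^sub>v v)" if v: "v \<in> carrier_vec (n + q)" for v
  proof -
    define x y where "x = vec_first v n" and "y = vec_last v q"
    have xy: "x \<in> carrier_vec n" "y \<in> carrier_vec q" "v = x @\<^sub>v y"
      using v by (auto simp: x_def y_def)
    have "four_block_mat A (0\<^sub>m n q) (0\<^sub>m q n) B *\<^sub>v v = (A *\<^sub>v x) @\<^sub>v (B *\<^sub>v y)"
      unfolding xy(3) using A B xy by (subst four_block_mat_mult_vec[of _ n n _ q _ q]) auto
    then have "v \<bullet> (four_block_mat A (0\<^sub>m n q) (0\<^sub>m q n) B *\<^sub>v v) = x \<bullet> (A *\<^sub>v x) + y \<bullet> (B *\<^sub>v y)"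
      using xy A B by (simp add: scalar_prod_append[of _ n _ q])
    then show ?thesis using assms xy by (simp add: psd_mat_def)
  qed
  moreover have "(four_block_mat A (0\<^sub>m n q) (0\<^sub>m q n) B)\<^sup>T = four_block_mat A (0\<^sub>m n q) (0\<^sub>m q n) B"
    using A B by (subst transpose_four_block_mat[of _ n n _ q _ q]) auto
  ultimately show ?thesis using A B by (auto simp: psd_mat_def)
qed

section \<open>The pencil and the witness matrices\<close>

lemma index_lincomb_mat [simp]:
  "r < n \<Longrightarrow> s < n \<Longrightarrow> lincomb_mat n Ms z $$ (r, s) = (\<Sum>i<length Ms. z i * Ms ! i $$ (r, s))"
  by (simp add: lincomb_mat_def)

lemma lincomb_mat_carrier [simp]: "lincomb_mat n Ms z \<in> carrier_mat n n"
  "dim_row (lincomb_mat n Ms z) = n" "dim_col (lincomb_mat n Ms z) = n"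
  by (simp_all add: lincomb_mat_def)

text \<open>The matrix inside \<open>mixed_char\<close>, with x an argument so that a sum of new
  variables can replace it.\<close>

definition pencil :: "nat \<Rightarrow> real mat list \<Rightarrow> (nat \<Rightarrow> real) \<Rightarrow> real \<Rightarrow> real mat" where
  "pencil d As z x = x \<cdot>\<^sub>m 1\<^sub>m d + lincomb_mat d As z"

lemma index_pencil [simp]:
  "r < d \<Longrightarrow> s < d \<Longrightarrow> pencil d As z x $$ (r, s) =
    x * 1\<^sub>m d $$ (r, s) + (\<Sum>i<length As. z i * As ! i $$ (r, s))"
  by (simp add: pencil_def)

lemma pencil_carrier [simp]: "pencil d As z x \<in> carrier_mat d d"
  "dim_row (pencil d As z x) = d" "dim_col (pencil d As z x) = d"
  by (simp_all add: pencil_def)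

text \<open>The witnesses \<open>Bs\<close>. The lower right block of their combination is the sum
  of the first m variables times the identity of size q = m - k, supplying the variables missing
  from a multiaffine monomial of degree k. The padding matrices contribute only to the x-part of the
  pencil.\<close>

definition blocks :: "nat \<Rightarrow> real mat list \<Rightarrow> nat \<Rightarrow> real mat list" where
  "blocks d As k = (let q = length As - k in
     map (\<lambda>A. four_block_mat A (0\<^sub>m d q) (0\<^sub>m q d) (1\<^sub>m q)) As @
     replicate (d - k) (four_block_mat (1\<^sub>m d) (0\<^sub>m d q) (0\<^sub>m q d) (0\<^sub>m q q)))"

lemma length_blocks [simp]: "length (blocks d As k) = length As + (d - k)"
  by (simp add: blocks_def Let_def)

lemma psd_blocks:
  assumes "\<forall>A\<in>set As. psd_mat d A" "B \<in> set (blocks d As k)"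
  shows "psd_mat (d + (length As - k)) B"
  using assms by (auto simp: blocks_def Let_def psd_four_block_mat psd_one_mat psd_zero_mat)

section \<open>Three quantities in terms of the multiaffine coefficient sum\<close>

text \<open>\<open>J\<close> indexes terms, not distinct monomials; \<open>a j\<close> holds the
  exponents of the z-variables and \<open>b j\<close> that of x. Beyond this expansion only its
  homogeneity enters the coefficient identities.\<close>

locale pencil_expansion =
  fixes d :: nat and As :: "real mat list" and J :: "'j set" and c :: "'j \<Rightarrow> real"
    and a :: "'j \<Rightarrow> nat \<Rightarrow> nat" and b :: "'j \<Rightarrow> nat"
  assumes finite_J: "finite J"
    and homogeneous: "j \<in> J \<Longrightarrow> (\<Sum>i<length As. a j i) + b j = d"
    and det_pencil: "det (pencil d As z x) =
      (\<Sum>j\<in>J. c j * (\<Prod>i<length As. z i ^ a j i) * x ^ b j)"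
begin

text \<open>Homogeneity makes every monomial counted here the product of exactly \<open>k\<close> distinct variables
  \<open>z_i\<close> with \<open>x^(d - k)\<close>.\<close>

definition multiaffine_coeff :: "nat \<Rightarrow> real" where
  "multiaffine_coeff k =
    (\<Sum>j\<in>J. if b j = d - k \<and> (\<forall>i<length As. a j i \<le> 1) then c j else 0)"

lemma mixed_char_eq_poly:
  assumes "k \<le> d"
  shows "\<exists>p. (\<forall>x. poly p x = mixed_char d As x) \<and>
    coeff p (d - k) = (- 1) ^ k * multiaffine_coeff k"
proof -
  \<comment> \<open>The value at the origin of the product of all 1 - d/dz_i applied to the z-part
    of term j.\<close>
  define w where "w j = (\<Prod>i<length As. if a j i = 0 then 1 else if a j i = 1 then - 1 else (0 :: real))" for j
  define p where "p = (\<Sum>j\<in>J. monom (c j * w j) (b j))"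
  have "poly p x = mixed_char d As x" for x
  proof -
    have "mixed_char d As x = foldr (affine_partial 1 (- 1)) [0..<length As]
        (\<lambda>z. \<Sum>j\<in>J. (c j * x ^ b j) * (\<Prod>i<length As. z i ^ a j i)) (\<lambda>_. 0)"
      unfolding mixed_char_def one_minus_partial_eq_affine_partial pencil_def[symmetric] det_pencil
      by (simp add: mult.assoc mult.commute mult.left_commute)
    also have "\<dots> = (\<Sum>j\<in>J. (c j * x ^ b j) * w j)"
      unfolding foldr_affine_partial_monomials_0 w_def ..
    finally show ?thesis
      by (simp add: p_def poly_sum poly_monom mult.commute mult.left_commute)
  qed
  moreover have "coeff p (d - k) = (- 1) ^ k * multiaffine_coeff k"
  proof -
    have "(if b j = d - k then c j * w j else 0) =
        (- 1) ^ k * (if b j = d - k \<and> (\<forall>i<length As. a j i \<le> 1) then c j else 0)"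
      if j: "j \<in> J" for j
    proof (cases "b j = d - k \<and> (\<forall>i<length As. a j i \<le> 1)")
      case True
      then have "w j = (\<Prod>i<length As. (- 1) ^ a j i)"
        unfolding w_def by (intro prod.cong) (auto simp: le_Suc_eq)
      also have "\<dots> = (- 1) ^ (\<Sum>i<length As. a j i)"
        by (simp add: power_sum)
      also have "(\<Sum>i<length As. a j i) = k"
        using homogeneous[OF j] True assms by simp
      finally show ?thesis using True by simp
    next
      case False
      have "w j = 0" if "i < length As" "\<not> a j i \<le> 1" for i
        unfolding w_def using that by (intro prod_zero bexI[of _ i]) auto
      then show ?thesis using False by auto
    qed
    then show ?thesis
      by (simp add: p_def coeff_sum multiaffine_coeff_def sum_distrib_left cong: sum.cong)
  qed
  ultimately show ?thesis by blast
qed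

text \<open>Setting the variables outside S to 0 and x to the sum of the d - k padding variables
  turns the pencil into the matrix of the padded discriminant. The resulting
  \<open>fact (d - k)\<close> cancels against the normalisation.\<close>

lemma mixed_disc_pad_nths:
  assumes "S \<subseteq> {..<length As}" "card S = k" "k \<le> d"
  shows "mixed_disc_pad d (nths As S) =
    (\<Sum>j\<in>J. if b j = d - k \<and> (\<forall>i\<in>{..<length As} - S. a j i = 0) \<and> (\<forall>i\<in>S. a j i \<le> 1)
      then c j else 0)"
proof -
  obtain e where e: "bij_betw e {..<k} S" and len: "length (nths As S) = k"
    and nth: "\<And>i. i < k \<Longrightarrow> nths As S ! i = As ! e i"
    using nths_enumeration[OF assms(1)] assms(2) by metis
  \<comment> \<open>The position in the sublist of the matrix with index i.\<close>
  define f where "f = the_inv_into {..<k} e"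
  have f: "f (e i) = i" if "i < k" for i
    using that e by (auto simp: f_def bij_betw_def the_inv_into_f_f)
  define Ms where "Ms = nths As S @ replicate (d - k) (1\<^sub>m d)"
  have lenMs: "length Ms = k + (d - k)" using len by (simp add: Ms_def)
  define y where "y z i = (if i \<in> S then z (f i) else 0)" for z :: "nat \<Rightarrow> real" and i
  \<comment> \<open>The terms that survive when the variables outside S vanish.\<close>
  define J' where "J' = {j \<in> J. \<forall>i\<in>{..<length As} - S. a j i = 0}"
  have lincomb: "lincomb_mat d Ms z = pencil d As (y z) (\<Sum>l<d - k. z (k + l))" for z
  proof (intro eq_matI)
    fix r s assume rs: "r < dim_row (pencil d As (y z) (\<Sum>l<d - k. z (k + l)))"
      "s < dim_col (pencil d As (y z) (\<Sum>l<d - k. z (k + l)))"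
    have "(\<Sum>i<length As. y z i * As ! i $$ (r, s)) = (\<Sum>i\<in>S. z (f i) * As ! i $$ (r, s))"
      using assms(1) by (intro sum.mono_neutral_cong_right) (auto simp: y_def)
    also have "\<dots> = (\<Sum>i<k. z (f (e i)) * As ! e i $$ (r, s))"
      by (rule sum.reindex_bij_betw[OF e, symmetric])
    also have "\<dots> = (\<Sum>i<k. z i * Ms ! i $$ (r, s))"
      by (intro sum.cong) (auto simp: f nth Ms_def nth_append len)
    finally have "(\<Sum>i<length As. y z i * As ! i $$ (r, s)) = \<dots>" .
    moreover have "(\<Sum>l<d - k. z (k + l) * Ms ! (k + l) $$ (r, s)) =
        (\<Sum>l<d - k. z (k + l)) * 1\<^sub>m d $$ (r, s)"
      unfolding sum_distrib_right by (intro sum.cong) (auto simp: Ms_def nth_append len)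
    ultimately show "lincomb_mat d Ms z $$ (r, s) =
        pencil d As (y z) (\<Sum>l<d - k. z (k + l)) $$ (r, s)"
      using rs by (simp add: lenMs sum_lessThan_add del: index_one_mat)
  qed auto
  have monomial: "(\<Prod>i<length As. y z i ^ a j i) =
      (if \<forall>i\<in>{..<length As} - S. a j i = 0 then \<Prod>i<k. z i ^ a j (e i) else 0)" for z j
  proof (cases "\<forall>i\<in>{..<length As} - S. a j i = 0")
    case True
    then have "(\<Prod>i<length As. y z i ^ a j i) = (\<Prod>i\<in>S. z (f i) ^ a j i)"
      using assms(1) by (intro prod.mono_neutral_cong_right) (auto simp: y_def)
    also have "\<dots> = (\<Prod>i<k. z (f (e i)) ^ a j (e i))"
      by (rule prod.reindex_bij_betw[OF e, symmetric])
    also have "\<dots> = (\<Prod>i<k. z i ^ a j (e i))"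
      by (intro prod.cong) (auto simp: f)
    finally show ?thesis using True by simp
  next
    case False
    then show ?thesis
      by (simp only: if_False) (rule prod_zero, auto simp: y_def)
  qed
  \<comment> \<open>The zeroth power matches \<open>foldr_partial_monomials_powers_0\<close> with q
    = 0.\<close>
  have "mixed_disc Ms = foldr partial [0..<k + (d - k)] (\<lambda>z. \<Sum>j\<in>J'. c j *
      (\<Prod>i<k. z i ^ a j (e i)) * (\<Sum>i<k. z i) ^ 0 * (\<Sum>l<d - k. z (k + l)) ^ b j) (\<lambda>_. 0)"
  proof -
    have "det (lincomb_mat d Ms z) = (\<Sum>j\<in>J'. c j *
      (\<Prod>i<k. z i ^ a j (e i)) * (\<Sum>i<k. z i) ^ 0 * (\<Sum>l<d - k. z (k + l)) ^ b j)" for z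
      unfolding lincomb det_pencil monomial J'_def
      using finite_J by (intro sum.mono_neutral_cong_right) auto
    then show ?thesis
      using lenMs assms(3) by (simp add: mixed_disc_def)
  qed
  also have "\<dots> = (\<Sum>j\<in>J'. if b j = d - k \<and> (\<forall>i<k. a j (e i) \<le> 1)
      then c j * fact 0 * fact (d - k) else 0)"
  proof (rule foldr_partial_monomials_powers_0)
    fix j assume j: "j \<in> J'" "b j = d - k"
    have "(\<Sum>i<k. a j (e i)) = (\<Sum>i\<in>S. a j i)"
      by (rule sum.reindex_bij_betw[OF e])
    also have "\<dots> = (\<Sum>i<length As. a j i)"
      using j assms(1) by (intro sum.mono_neutral_left) (auto simp: J'_def)
    finally show "(\<Sum>i<k. a j (e i)) + 0 = k"
      using homogeneous[of j] j assms(3) by (simp add: J'_def)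
  qed (use finite_J in \<open>simp add: J'_def\<close>)
  also have "\<dots> = (\<Sum>j\<in>J. if b j = d - k \<and> (\<forall>i\<in>{..<length As} - S. a j i = 0) \<and> (\<forall>i\<in>S. a j i \<le> 1)
      then c j else 0) * fact (d - k)"
  proof -
    have "(\<forall>i<k. a j (e i) \<le> 1) \<longleftrightarrow> (\<forall>i\<in>S. a j i \<le> 1)" for j
      using e by (auto simp: bij_betw_def)
    then show ?thesis
      unfolding sum_distrib_right J'_def
      using finite_J by (intro sum.mono_neutral_cong_left) auto
  qed
  finally show ?thesis
    by (simp add: mixed_disc_pad_def len Ms_def)
qed

text \<open>After exchanging the sums, a multiaffine term with x-degree d - k is counted for exactly
  one S, its set of occurring variables; every other term is counted for none.\<close>

lemma sum_mixed_disc_pad: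
  assumes "k \<le> d"
  shows "(\<Sum>S | S \<subseteq> {..<length As} \<and> card S = k. mixed_disc_pad d (nths As S)) = multiaffine_coeff k"
proof -
  define \<S> where "\<S> = {S. S \<subseteq> {..<length As} \<and> card S = k}"
  have fin: "finite \<S>" by (simp add: \<S>_def)
  define P where "P j S \<longleftrightarrow> b j = d - k \<and> (\<forall>i\<in>{..<length As} - S. a j i = 0) \<and> (\<forall>i\<in>S. a j i \<le> 1)"
    for j S
  have "(\<Sum>S\<in>\<S>. mixed_disc_pad d (nths As S)) = (\<Sum>S\<in>\<S>. \<Sum>j\<in>J. if P j S then c j else 0)"
    unfolding P_def using assms by (intro sum.cong mixed_disc_pad_nths refl) (auto simp: \<S>_def)
  also have "\<dots> = (\<Sum>j\<in>J. \<Sum>S\<in>\<S>. if P j S then c j else 0)"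
    by (rule sum.swap)
  also have "\<dots> = multiaffine_coeff k"
    unfolding multiaffine_coeff_def
  proof (intro sum.cong refl)
    fix j assume j: "j \<in> J"
    define T where "T = {i. i < length As \<and> a j i \<noteq> 0}"
    have T: "T \<subseteq> {..<length As}" "finite T" by (auto simp: T_def)
    show "(\<Sum>S\<in>\<S>. if P j S then c j else 0) =
        (if b j = d - k \<and> (\<forall>i<length As. a j i \<le> 1) then c j else 0)"
    proof (cases "b j = d - k \<and> (\<forall>i<length As. a j i \<le> 1)")
      case True
      have "card T = (\<Sum>i\<in>T. a j i)"
        unfolding card_eq_sum using True by (intro sum.cong) (auto simp: T_def le_Suc_eq)
      also have "\<dots> = (\<Sum>i<length As. a j i)"
        by (intro sum.mono_neutral_left) (auto simp: T_def)
      finally have card: "card T = k"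
        using homogeneous[OF j] True assms by simp
      \<comment> \<open>\<open>P j S\<close> forces S to contain the support T, and both have k
        elements.\<close>
      have "P j S \<longleftrightarrow> S = T" if "S \<in> \<S>" for S
      proof
        assume "P j S"
        then have "i \<in> S" if "i < length As" "a j i \<noteq> 0" for i
          using that by (cases "i \<in> S") (auto simp: P_def)
        then have "T \<subseteq> S" by (auto simp: T_def)
        moreover have "finite S" using that finite_subset by (auto simp: \<S>_def)
        ultimately show "S = T" using card_subset_eq[of S T] card that by (auto simp: \<S>_def)
      next
        assume "S = T"
        then show "P j S" using True by (auto simp: P_def T_def)
      qed
      then have "(\<Sum>S\<in>\<S>. if P j S then c j else 0) = (\<Sum>S\<in>\<S>. if S = T then c j else 0)"
        by (intro sum.cong) auto
      also have "\<dots> = c j"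
        using fin T card by (simp add: \<S>_def)
      finally show ?thesis using True by simp
    next
      case False
      have "\<not> P j S" if "S \<in> \<S>" for S
        using False unfolding P_def by (metis DiffI le0 lessThan_iff)
      then show ?thesis using False by auto
    qed
  qed
  finally show ?thesis unfolding \<S>_def .
qed

text \<open>The combination is block diagonal, so its determinant is that of the pencil times the
  q-th power of the sum of the first m variables.\<close>

lemma mixed_disc_blocks:
  assumes "\<forall>A\<in>set As. A \<in> carrier_mat d d" "k \<le> d" "k \<le> length As"
  shows "mixed_disc (blocks d As k) = fact (length As - k) * fact (d - k) * multiaffine_coeff k"
proof -
  define m q p where "m = length As" and "q = length As - k" and "p = d - k"
  \<comment> \<open>The first equation says that there are as many blocks as rows in each, as
    \<open>mixed_disc\<close> requires.\<close>
  have sizes: "m + p = d + q" "q + k = m" "p + k = d"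
    using assms by (auto simp: m_def q_def p_def)
  have lincomb: "lincomb_mat (d + q) (blocks d As k) z =
      four_block_mat (pencil d As z (\<Sum>l<p. z (m + l))) (0\<^sub>m d q) (0\<^sub>m q d) ((\<Sum>i<m. z i) \<cdot>\<^sub>m 1\<^sub>m q)"
    (is "_ = ?M") for z
  proof (intro eq_matI)
    fix r s assume "r < dim_row ?M" "s < dim_col ?M"
    then have rs: "r < d + q" "s < d + q" by auto
    have low: "(\<Sum>i<m. z i * blocks d As k ! i $$ (r, s)) = (\<Sum>i<m. z i *
        (if r < d then if s < d then As ! i $$ (r, s) else 0
         else if s < d then 0 else 1\<^sub>m q $$ (r - d, s - d)))"
    proof (intro sum.cong refl)
      fix i assume "i \<in> {..<m}"
      then have "blocks d As k ! i = four_block_mat (As ! i) (0\<^sub>m d q) (0\<^sub>m q d) (1\<^sub>m q)"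
        "As ! i \<in> carrier_mat d d"
        using assms(1) by (auto simp: blocks_def Let_def m_def q_def nth_append)
      then show "z i * blocks d As k ! i $$ (r, s) = z i *
        (if r < d then if s < d then As ! i $$ (r, s) else 0
         else if s < d then 0 else 1\<^sub>m q $$ (r - d, s - d))"
        using rs by (simp del: index_one_mat(1))
    qed
    have high: "(\<Sum>l<p. z (m + l) * blocks d As k ! (m + l) $$ (r, s)) =
        (\<Sum>l<p. z (m + l)) * (if r < d \<and> s < d then 1\<^sub>m d $$ (r, s) else 0)"
      unfolding sum_distrib_right
    proof (intro sum.cong refl)
      fix l assume "l \<in> {..<p}"
      then have "blocks d As k ! (m + l) = four_block_mat (1\<^sub>m d) (0\<^sub>m d q) (0\<^sub>m q d) (0\<^sub>m q q)"
        by (simp add: blocks_def Let_def m_def q_def p_def nth_append)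
      then show "z (m + l) * blocks d As k ! (m + l) $$ (r, s) =
          z (m + l) * (if r < d \<and> s < d then 1\<^sub>m d $$ (r, s) else 0)"
        using rs by (simp del: index_one_mat(1))
    qed
    have "lincomb_mat (d + q) (blocks d As k) z $$ (r, s) =
        (\<Sum>i<m. z i * blocks d As k ! i $$ (r, s)) + (\<Sum>l<p. z (m + l) * blocks d As k ! (m + l) $$ (r, s))"
      using rs by (simp add: m_def[symmetric] p_def[symmetric] sum_lessThan_add)
    then show "lincomb_mat (d + q) (blocks d As k) z $$ (r, s) = ?M $$ (r, s)"
      unfolding low high using rs
      by (auto simp: m_def[symmetric] sum_distrib_right[symmetric] simp del: index_one_mat(1))
  qed auto
  have "det (lincomb_mat (d + q) (blocks d As k) z) = (\<Sum>j\<in>J. c j * (\<Prod>i<m. z i ^ a j i) *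
      (\<Sum>i<m. z i) ^ q * (\<Sum>l<p. z (m + l)) ^ b j)" for z
  proof -
    have "det (lincomb_mat (d + q) (blocks d As k) z) =
        det (pencil d As z (\<Sum>l<p. z (m + l))) * (\<Sum>i<m. z i) ^ q"
      unfolding lincomb by (subst det_four_block_mat_upper_right_zero[of _ d _ q]) auto
    then show ?thesis
      by (simp add: det_pencil m_def sum_distrib_left sum_distrib_right mult.assoc mult.commute mult.left_commute)
  qed
  then have "mixed_disc (blocks d As k) = foldr partial [0..<m + p] (\<lambda>z. \<Sum>j\<in>J. c j *
      (\<Prod>i<m. z i ^ a j i) * (\<Sum>i<m. z i) ^ q * (\<Sum>l<p. z (m + l)) ^ b j) (\<lambda>_. 0)"
    by (simp add: sizes(1) mixed_disc_def m_def[symmetric] p_def[symmetric])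
  also have "\<dots> = (\<Sum>j\<in>J. if b j = p \<and> (\<forall>i<m. a j i \<le> 1) then c j * fact q * fact p else 0)"
    \<comment> \<open>For \<open>b j = p\<close> the z-degree is d - p = k, and k + q = m is the
      required degree condition.\<close>
    using homogeneous sizes
    by (intro foldr_partial_monomials_powers_0 finite_J) (fastforce simp: m_def[symmetric])
  also have "\<dots> = fact q * fact p * multiaffine_coeff k"
    by (auto simp: multiaffine_coeff_def sum_distrib_left m_def p_def intro!: sum.cong)
  finally show ?thesis unfolding q_def p_def .
qed

end

section \<open>From the determinant expansion to the coefficient and the witnesses\<close>

theorem theorem5p3:
  fixes As :: "real mat list" and d m k :: nat
  assumes "length As = m"
    and "\<forall>A \<in> set As. psd_mat d A"
    and "d \<le> m"
    and "k \<in> {1..d}"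
  shows "(\<exists>p :: real poly. (\<forall>x. poly p x = mixed_char d As x) \<and>
            coeff p (d - k) =
              (- 1) ^ k * (\<Sum>S | S \<subseteq> {..<m} \<and> card S = k. mixed_disc_pad d (nths As S)))
       \<and> (\<exists>Bs :: real mat list. length Bs = m + d - k \<and>
            (\<forall>B \<in> set Bs. psd_mat (m + d - k) B) \<and>
            (\<Sum>S | S \<subseteq> {..<m} \<and> card S = k. mixed_disc_pad d (nths As S)) =
              1 / (fact (m - k) * fact (d - k)) * mixed_disc Bs)"
proof -
  \<comment> \<open>Appending the identity makes x an ordinary variable, of index m, so the
    expansion of linear combinations covers the pencil; \<open>a j m\<close> is then the exponent of
    x.\<close>
  define Ms where "Ms = As @ [1\<^sub>m d]"
  have len: "length Ms = Suc m" using assms(1) by (simp add: Ms_def)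
  obtain J :: "((nat \<Rightarrow> nat) \<times> (nat \<Rightarrow> nat)) set" and c a where
    J: "finite J" "\<And>j. j \<in> J \<Longrightarrow> (\<Sum>i<Suc m. a j i) = d"
    and det: "\<And>z. det (lincomb_mat d Ms z) = (\<Sum>j\<in>J. c j * (\<Prod>i<Suc m. z i ^ a j i))"
    by (rule det_lincomb_mat_expansion[OF len, of d]) (rule that)
  interpret pencil_expansion d As J c a "\<lambda>j. a j m"
  proof
    show "finite J" by fact
    show "(\<Sum>i<length As. a j i) + a j m = d" if "j \<in> J" for j
      using J(2)[OF that] assms(1) by simp
    fix z x
    have "pencil d As z x = lincomb_mat d Ms (z(m := x))"
    proof (intro eq_matI)
      fix r s assume rs: "r < dim_row (lincomb_mat d Ms (z(m := x)))"
        "s < dim_col (lincomb_mat d Ms (z(m := x)))"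
      have "(\<Sum>i<m. (z(m := x)) i * Ms ! i $$ (r, s)) = (\<Sum>i<m. z i * As ! i $$ (r, s))"
        using assms(1) by (intro sum.cong) (auto simp: Ms_def nth_append)
      moreover have "Ms ! m = 1\<^sub>m d" using assms(1) by (simp add: Ms_def nth_append)
      ultimately show "pencil d As z x $$ (r, s) = lincomb_mat d Ms (z(m := x)) $$ (r, s)"
        using rs by (simp add: len assms(1) del: index_one_mat(1) fun_upd_apply) simp
    qed auto
    then have "det (pencil d As z x) = (\<Sum>j\<in>J. c j * (\<Prod>i<Suc m. (z(m := x)) i ^ a j i))"
      by (simp only: det)
    also have "\<dots> = (\<Sum>j\<in>J. c j * (\<Prod>i<m. z i ^ a j i) * x ^ a j m)"
      by (intro sum.cong refl) (simp add: mult.assoc)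
    finally show "det (pencil d As z x) =
        (\<Sum>j\<in>J. c j * (\<Prod>i<length As. z i ^ a j i) * x ^ a j m)"
      using assms(1) by simp
  qed
  have k: "k \<le> d" "k \<le> m" using assms by auto
  \<comment> \<open>The truncated subtractions agree because k \<le> d \<le> m.\<close>
  have size: "d + (length As - k) = m + d - k" using assms(1) k by simp
  have sum: "(\<Sum>S | S \<subseteq> {..<m} \<and> card S = k. mixed_disc_pad d (nths As S)) = multiaffine_coeff k"
    using sum_mixed_disc_pad[OF k(1)] assms(1) by simp
  have "mixed_disc (blocks d As k) = fact (m - k) * fact (d - k) * multiaffine_coeff k"
    using mixed_disc_blocks[of k] assms k by (simp add: psd_mat_def)
  then have "multiaffine_coeff k = 1 / (fact (m - k) * fact (d - k)) * mixed_disc (blocks d As k)"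
    by simp
  moreover have "length (blocks d As k) = m + d - k" using assms(1) k by simp
  moreover have "\<forall>B\<in>set (blocks d As k). psd_mat (m + d - k) B"
    using psd_blocks[OF assms(2), where k = k] unfolding size by blast
  ultimately show ?thesis
    using mixed_char_eq_poly[OF k(1)] unfolding sum by blast
qed

end
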